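(* Let $s \in [0,1]\cap\mathbb{Q}$, and let $s = 0.a_1a_2\ldots$ be a (lower or upper) binary expansion of $s$, which is eventually periodic. Let $n$ be the length of its period and let $p = a_k\ldots a_{k+n-1}$ be its period (where $k\ge 1$ is such that $a_{i+n} = a_i$ for all $i\geq k$). Then $\vec{M}_p$ has distinct, positive, real eigenvalues, the Hölder exponent $\alpha(u,s)$ exists, and $$\alpha(u, s) = \frac{\ln \lambda_{p}}{n \ln \frac{1}{2}},$$ where $\lambda_p$ is the bigger eigenvalue of $\vec{M}_p$.
   Context: Let $M_0 = \frac{1}{5}\begin{pmatrix} 5 & 2 & 2\\ 0 & 2 & 1\\ 0 & 1 & 2 \end{pmatrix}$ and $M_1 = \frac{1}{5}\begin{pmatrix} 2 & 0 & 1\\ 2 & 5 & 2\\ 1 & 0 & 2 \end{pmatrix}$, and let $h_0(x) = \frac{x}{2}$, $h_1(x) = \frac{x+1}{2}$. Let $u:[0,1]\to\mathbb{R}^3$ be the unique continuous function satisfying $u(0) = (1,0,0)^T$, $u(1) = (0,1,0)^T$, $u\circ h_0 = M_0\circ u$ and $u \circ h_1 = M_1\circ u$ on $[0,1]$ (this function is known to exist, to be unique, and to be injective). Let $\vec{\mathcal{H}} = \{(x,y,z)\in\mathbb{R}^3 : x+y+z=0\}$, a vector plane stable by $M_0$ and $M_1$, and let $\vec{M}_i$ be the restriction of $M_i$ to $\vec{\mathcal{H}}$, for $i \in \{0,1\}$. For a finite word $a_1\ldots a_n$ on $\{0,1\}$, $\vec{M}_{a_1\ldots a_n} := \vec{M}_{a_1}\cdots\vec{M}_{a_n}$.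 The Hölder exponent of $u$ in $s$ is, when the limit exists, $$\alpha(u, s) := \lim_{t \to s,\ t \in [0, 1],\ t\ne s}\frac{\ln \|u(t) - u(s)\|}{\ln |t-s|},$$ where $\|\cdot\|$ is any norm on $\mathbb{R}^3$ (the choice does not matter). For $s\in[0,1)$ (resp. $s\in(0,1]$), the upper (resp. lower) binary expansion of $s$ is the unique sequence $(a_i)_{i\ge1}$ in $\{0,1\}$ with $s = \sum_{i\ge1} a_i2^{-i}$ that does not end with an infinite sequence of $1$'s (resp. of $0$'s). *)

theory Defs
  imports "HOL-Analysis.Analysis"
begin

definition M0 :: "real^3^3" where
  "M0 = (1/5) *\<^sub>R vector [vector [5, 2, 2], vector [0, 2, 1], vector [0, 1, 2]]"

definition M1 :: "real^3^3" where
  "M1 = (1/5) *\<^sub>R vector [vector [2, 0, 1], vector [2, 5, 2], vector [1, 0, 2]]"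

(* Only the digits 0 and 1 are meant as arguments. *)
definition M :: "nat \<Rightarrow> real^3^3" where
  "M i = (if i = 0 then M0 else M1)"

definition h0 :: "real \<Rightarrow> real" where "h0 x = x / 2"
definition h1 :: "real \<Rightarrow> real" where "h1 x = (x + 1) / 2"

(* u is a total function, but only its values on {0..1} are constrained;
   the curve of the paper is the restriction of any such u to {0..1}. *)
definition is_curve :: "(real \<Rightarrow> real^3) \<Rightarrow> bool" where
  "is_curve u \<longleftrightarrow>
     continuous_on {0..1} u \<and>
     u 0 = vector [1, 0, 0] \<and> u 1 = vector [0, 1, 0] \<and>
     (\<forall>x\<in>{0..1}. u (h0 x) = M0 *v u x) \<and>
     (\<forall>x\<in>{0..1}. u (h1 x) = M1 *v u x)"

definition plane :: "(real^3) set" where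
  "plane = {v. v $ 1 + v $ 2 + v $ 3 = 0}"

(* restrict and compose are those of HOL-Library.FuncSet. *)
definition vecM :: "nat \<Rightarrow> real^3 \<Rightarrow> real^3" where
  "vecM i = restrict (\<lambda>v. M i *v v) plane"

primrec vecM_word :: "nat list \<Rightarrow> real^3 \<Rightarrow> real^3" where
  "vecM_word [] = restrict (\<lambda>v. v) plane"
| "vecM_word (a # w) = compose plane (vecM a) (vecM_word w)"

(* Real eigenvalues of f seen as an endomorphism of the subspace V. If V is a plane and
   this set has two elements, then they are all the eigenvalues of f, complex ones included. *)
definition eigenvalues_on :: "'a::real_vector set \<Rightarrow> ('a \<Rightarrow> 'a) \<Rightarrow> real set" where
  "eigenvalues_on V f = {c. \<exists>v\<in>V. v \<noteq> 0 \<and> f v = c *\<^sub>R v}"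

definition is_norm :: "('a::real_vector \<Rightarrow> real) \<Rightarrow> bool" where
  "is_norm N \<longleftrightarrow>
     (\<forall>x. 0 \<le> N x) \<and>
     (\<forall>x. N x = 0 \<longleftrightarrow> x = 0) \<and>
     (\<forall>c x. N (c *\<^sub>R x) = \<bar>c\<bar> * N x) \<and>
     (\<forall>x y. N (x + y) \<le> N x + N y)"

(* "The Hoelder exponent of u in s, taken with respect to the norm N, exists and equals l." *)
definition has_holder_exponent ::
    "('a::real_vector \<Rightarrow> real) \<Rightarrow> (real \<Rightarrow> 'a) \<Rightarrow> real \<Rightarrow> real \<Rightarrow> bool" where
  "has_holder_exponent N u s l \<longleftrightarrow>
     ((\<lambda>t. ln (N (u t - u s)) / ln \<bar>t - s\<bar>) \<longlongrightarrow> l) (at s within {0..1})"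

(* Digit sequences are indexed from 1; the value a 0 is irrelevant. *)
definition binary_expansion :: "(nat \<Rightarrow> nat) \<Rightarrow> real \<Rightarrow> bool" where
  "binary_expansion a s \<longleftrightarrow>
     (\<forall>i\<ge>1. a i \<in> {0, 1}) \<and> (\<lambda>i. real (a (Suc i)) * (1/2) ^ Suc i) sums s"

definition upper_binary_expansion :: "(nat \<Rightarrow> nat) \<Rightarrow> real \<Rightarrow> bool" where
  "upper_binary_expansion a s \<longleftrightarrow>
     s \<in> {0..<1} \<and> binary_expansion a s \<and> \<not> (\<exists>m\<ge>1. \<forall>i\<ge>m. a i = 1)"

definition lower_binary_expansion :: "(nat \<Rightarrow> nat) \<Rightarrow> real \<Rightarrow> bool" where
  "lower_binary_expansion a s \<longleftrightarrow>
     s \<in> {0<..1} \<and> binary_expansion a s \<and> \<not> (\<exists>m\<ge>1. \<forall>i\<ge>m. a i = 0)"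

end

theory Submission
  imports Defs
begin

text \<open>
  Write a vector of the plane as $(x, y, z)$ and use the two gaps $z - x$ and $y - z$ as
  coordinates. Both matrices then become triangular with non-negative entries, so they preserve
  the cone of the vectors with $x \<le> z \<le> y$, and every increment $u(t) - u(s)$ with
  $s \<le> t$ lies in that cone. Hence the curve is monotone for the order of the cone. On the
  cone all norms are comparable to the spread $y - x$, so the size of $u(t) - u(s)$ is, up to
  bounded factors, a monotone function of the distance from $t$ to $s$, and it is enough to
  know it along one geometric sequence of parameters $t$ on each side of $s$.

  Such a sequence comes from self-similarity. Let $w$ be the part of the expansion before the
  period $p$, let $\<sigma>$ be the number with expansion $ppp\<dots>$, and let $\<tau>$ be an
  endpoint of the unit interval. The words $w p^j$ send $\<sigma>$ to $s$ and $\<tau>$ to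
  points $t_j$ at distance proportional to $2^{-nj}$ from $s$, and the increment of $u$ between
  them is the image under $M_w M_p^j$ of the increment between $\<sigma>$ and $\<tau>$. A
  Perron argument on two by two matrices (\<open>perron_word\<close>) gives the eigenvalues of $M_p$ and
  a left eigenvector, for the larger eigenvalue $\<lambda>_p$, with positive coordinates. This
  linear form is comparable to the spread on the cone and is multiplied by $\<lambda>_p$ at each
  step, so the increments are of order $\<lambda>_p^j$ (\<open>left_eigen_growth\<close>). This gives
  $\ln \<bar>u(t) - u(s)\<bar> = \<alpha> \ln \<bar>t - s\<bar> + O(1)$ on the side of $s$
  that corresponds to the side of $\<sigma>$ on which $\<tau>$ lies (\<open>one_sided_log_growth\<close>).

  Both sides are reached in this way unless $\<sigma>$ is $0$ or $1$. Then $s$ is dyadic and, if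
  it is interior to the interval, its other expansion serves for the missing side. The two periods are $0^n$ and $1^n$, and
  $(3/5)^n$ is the larger eigenvalue for both, so the two sides agree.
\<close>

section \<open>Words acting on the line and on the plane\<close>

definition word_map :: "nat list \<Rightarrow> real \<Rightarrow> real" where
  "word_map w x = foldr (\<lambda>i x. if i = 0 then h0 x else h1 x) w x"

definition word_act :: "nat list \<Rightarrow> real^3 \<Rightarrow> real^3" where
  "word_act w v = foldr (\<lambda>i v. M i *v v) w v"

lemma word_map_simps [simp]:
  "word_map [] x = x"
  "word_map (i # w) x = (if i = 0 then h0 (word_map w x) else h1 (word_map w x))"
  by (simp_all add: word_map_def)

lemma word_act_simps [simp]:
  "word_act [] v = v"
  "word_act (i # w) v = M i *v word_act w v"
  by (simp_all add: word_act_def)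

lemma word_map_append: "word_map (w @ w') x = word_map w (word_map w' x)"
  by (simp add: word_map_def)

lemma word_act_append: "word_act (w @ w') v = word_act w (word_act w' v)"
  by (simp add: word_act_def)

lemma word_act_diff: "word_act w (v - v') = word_act w v - word_act w v'"
  by (induction w) (simp_all add: matrix_vector_mult_diff_distrib)

lemma word_map_diff: "word_map w x - word_map w y = (x - y) / 2 ^ length w"
  by (induction w) (simp_all add: h0_def h1_def mult.commute flip: diff_divide_distrib divide_divide_eq_left)

lemma word_map_replicate:
  "word_map (replicate m 0) 0 = 0" "word_map (replicate m 1) 1 = 1"
proof -
  show "word_map (replicate m 0) 0 = 0" by (induction m) (simp_all add: h0_def)
  show "word_map (replicate m 1) 1 = 1" by (induction m) (simp_all add: h1_def)
qed

lemma word_map_in_unit: "x \<in> {0..1} \<Longrightarrow> word_map w x \<in> {0..1}"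
  by (induction w) (auto simp: h0_def h1_def)

lemma M0_components:
  "(M0 *v v) $ 1 = (5 * v $ 1 + 2 * v $ 2 + 2 * v $ 3) / 5"
  "(M0 *v v) $ 2 = (2 * v $ 2 + v $ 3) / 5"
  "(M0 *v v) $ 3 = (v $ 2 + 2 * v $ 3) / 5"
  by (simp_all add: M0_def matrix_vector_mult_def sum_3 add_divide_distrib)

lemma M1_components:
  "(M1 *v v) $ 1 = (2 * v $ 1 + v $ 3) / 5"
  "(M1 *v v) $ 2 = (2 * v $ 1 + 5 * v $ 2 + 2 * v $ 3) / 5"
  "(M1 *v v) $ 3 = (v $ 1 + 2 * v $ 3) / 5"
  by (simp_all add: M1_def matrix_vector_mult_def sum_3 add_divide_distrib)

lemma M_in_plane: "v \<in> plane \<Longrightarrow> M i *v v \<in> plane"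
  by (simp add: M_def plane_def M0_components M1_components field_simps)

lemma word_act_in_plane: "v \<in> plane \<Longrightarrow> word_act w v \<in> plane"
  by (induction w) (simp_all add: M_in_plane)

lemma vecM_word_eq_word_act: "v \<in> plane \<Longrightarrow> vecM_word w v = word_act w v"
  by (induction w) (simp_all add: compose_def vecM_def word_act_in_plane)

section \<open>The gap coordinates\<close>

text \<open>In these coordinates on the plane, \<open>M0\<close> and \<open>M1\<close> are one fifth of the triangular matrices
with rows (3, 1), (0, 1) and (1, 0), (1, 3). That no entry is negative is the point of this
choice; it fails in the coordinates $(y, z)$, for instance.\<close>

definition gap1 :: "real^3 \<Rightarrow> real" where "gap1 v = v $ 3 - v $ 1"
definition gap2 :: "real^3 \<Rightarrow> real" where "gap2 v = v $ 2 - v $ 3"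

definition of_gaps :: "real \<Rightarrow> real \<Rightarrow> real^3" where
  "of_gaps x y = vector [- (2 * x + y) / 3, (x + 2 * y) / 3, (x - y) / 3]"

lemma gaps_of_gaps [simp]: "gap1 (of_gaps x y) = x" "gap2 (of_gaps x y) = y"
  by (simp_all add: of_gaps_def gap1_def gap2_def field_simps)

lemma of_gaps_in_plane [simp]: "of_gaps x y \<in> plane"
  by (simp add: of_gaps_def plane_def field_simps)

lemma of_gaps_gaps: "v \<in> plane \<Longrightarrow> of_gaps (gap1 v) (gap2 v) = v"
  by (simp add: of_gaps_def plane_def gap1_def gap2_def vec_eq_iff forall_3 field_simps)

lemma plane_eq_iff_gaps:
  assumes "v \<in> plane" "w \<in> plane"
  shows "v = w \<longleftrightarrow> gap1 v = gap1 w \<and> gap2 v = gap2 w"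
  by (metis assms of_gaps_gaps)

lemma gaps_diff: "gap1 (v - w) = gap1 v - gap1 w" "gap2 (v - w) = gap2 v - gap2 w"
  by (simp_all add: gap1_def gap2_def)

lemma gaps_scaleR: "gap1 (c *\<^sub>R v) = c * gap1 v" "gap2 (c *\<^sub>R v) = c * gap2 v"
  by (simp_all add: gap1_def gap2_def right_diff_distrib)

lemma plane_scaleR: "v \<in> plane \<Longrightarrow> c *\<^sub>R v \<in> plane"
  by (simp add: plane_def flip: distrib_left)

lemma gaps_M:
  assumes "v \<in> plane"
  shows "gap1 (M i *v v) = (if i = 0 then (3 * gap1 v + gap2 v) / 5 else gap1 v / 5)"
    and "gap2 (M i *v v) = (if i = 0 then gap2 v / 5 else (gap1 v + 3 * gap2 v) / 5)"
  using assms
  by (simp_all add: M_def plane_def gap1_def gap2_def M0_components M1_components field_simps)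

section \<open>Eigenvalues of a word\<close>

text \<open>The entries are arguments of a predicate so that a word can be given its matrix by
induction without an explicit formula.\<close>

definition gap_matrix :: "nat list \<Rightarrow> real \<Rightarrow> real \<Rightarrow> real \<Rightarrow> real \<Rightarrow> bool" where
  "gap_matrix w a b c d \<longleftrightarrow> (\<forall>v\<in>plane.
     gap1 (word_act w v) = a * gap1 v + b * gap2 v \<and>
     gap2 (word_act w v) = c * gap1 v + d * gap2 v)"

lemma gap_matrix_Cons:
  assumes "gap_matrix w a b c d"
  shows "i = 0 \<Longrightarrow> gap_matrix (i # w) ((3 * a + c) / 5) ((3 * b + d) / 5) (c / 5) (d / 5)"
    and "i \<noteq> 0 \<Longrightarrow> gap_matrix (i # w) (a / 5) (b / 5) ((a + 3 * c) / 5) ((b + 3 * d) / 5)"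
  using assms by (simp_all add: gap_matrix_def word_act_in_plane gaps_M field_simps)

text \<open>What the Perron argument needs from the matrix with rows $(a, b)$ and $(c, d)$. The last
two clauses concern triangular matrices, those of the words $0^n$ and $1^n$: the larger diagonal
entry has to stand in the row of the non-zero off-diagonal entry. In the opposite case the left
eigenvector for the larger eigenvalue has a zero coordinate.\<close>

definition perron_entries :: "real \<Rightarrow> real \<Rightarrow> real \<Rightarrow> real \<Rightarrow> bool" where
  "perron_entries a b c d \<longleftrightarrow> a > 0 \<and> d > 0 \<and> b \<ge> 0 \<and> c \<ge> 0 \<and> a * d > b * c \<and>
     (b = 0 \<longrightarrow> c > 0 \<and> d > a) \<and> (c = 0 \<longrightarrow> b > 0 \<and> a > d)"

text \<open>The hypotheses weaken \<open>perron_entries\<close> just enough to admit the identity matrix, so that the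
induction over words can start at the empty word.\<close>

lemma perron_entries_Cons:
  assumes "a > 0" "d > 0" "b \<ge> 0" "c \<ge> 0" "a * d > b * c" "b = 0 \<Longrightarrow> d \<ge> a" "c = 0 \<Longrightarrow> a \<ge> d"
  shows "perron_entries ((3 * a + c) / 5) ((3 * b + d) / 5) (c / 5) (d / 5)"
    and "perron_entries (a / 5) (b / 5) ((a + 3 * c) / 5) ((b + 3 * d) / 5)"
  using assms by (auto simp: perron_entries_def algebra_simps add_pos_nonneg add_nonneg_pos)

lemma gap_matrix_nonempty:
  assumes "w \<noteq> []"
  shows "\<exists>a b c d. gap_matrix w a b c d \<and> perron_entries a b c d"
  using assms
proof (induction w)
  case (Cons i w)
  obtain a b c d where m: "gap_matrix w a b c d"
    and e: "a > 0" "d > 0" "b \<ge> 0" "c \<ge> 0" "a * d > b * c" "b = 0 \<Longrightarrow> d \<ge> a" "c = 0 \<Longrightarrow> a \<ge> d"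
  proof (cases "w = []")
    case True
    then have "gap_matrix w 1 0 0 1" by (simp add: gap_matrix_def)
    then show thesis by (rule that) auto
  next
    case False
    then obtain a b c d where "gap_matrix w a b c d" "perron_entries a b c d"
      using Cons.IH by blast
    then show thesis by (intro that) (auto simp: perron_entries_def)
  qed
  show ?case
    using gap_matrix_Cons[OF m, of i] perron_entries_Cons[OF e] by metis
qed simp

lemma gap_matrix_replicate_zero:
  "\<exists>b. gap_matrix (replicate n 0) ((3/5)^n) b 0 ((1/5)^n)"
proof (induction n)
  case 0
  then show ?case by (auto simp: gap_matrix_def)
next
  case (Suc n)
  then show ?case using gap_matrix_Cons(1)[of "replicate n 0" _ _ _ _ 0] by fastforce
qed

lemma gap_matrix_replicate_one:
  "\<exists>c. gap_matrix (replicate n 1) ((1/5)^n) 0 c ((3/5)^n)"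
proof (induction n)
  case 0
  then show ?case by (auto simp: gap_matrix_def)
next
  case (Suc n)
  then show ?case using gap_matrix_Cons(2)[of "replicate n 1" _ _ _ _ 1] by fastforce
qed

text \<open>The roots of the characteristic polynomial. A non-zero off-diagonal entry allows an
eigenvector to be written down for each root.\<close>

lemma eigenvalues_gap_matrix:
  assumes m: "gap_matrix w a b c d" and bc: "b \<noteq> 0 \<or> c \<noteq> 0"
  shows "eigenvalues_on plane (vecM_word w) = {t. (a - t) * (d - t) = b * c}"
proof (intro set_eqI iffI)
  fix t assume "t \<in> eigenvalues_on plane (vecM_word w)"
  then obtain v where v: "v \<in> plane" "v \<noteq> 0" "word_act w v = t *\<^sub>R v"
    by (auto simp: eigenvalues_on_def vecM_word_eq_word_act)
  define x y where "x = gap1 v" and "y = gap2 v"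
  have "0 \<in> plane" by (simp add: plane_def)
  moreover have "gap1 0 = 0" "gap2 0 = 0" by (simp_all add: gap1_def gap2_def)
  ultimately have nz: "x \<noteq> 0 \<or> y \<noteq> 0"
    using v plane_eq_iff_gaps[of v 0] by (auto simp: x_def y_def)
  have eq: "t * x = a * x + b * y" "t * y = c * x + d * y"
    using m v by (auto simp: gap_matrix_def gaps_scaleR x_def y_def)
  have "((a - t) * (d - t) - b * c) * x = 0" "((a - t) * (d - t) - b * c) * y = 0"
    using eq by algebra+
  with nz show "t \<in> {t. (a - t) * (d - t) = b * c}" by auto
next
  fix t assume t: "t \<in> {t. (a - t) * (d - t) = b * c}"
  \<comment> \<open>The eigenvector is read off from the row with the non-zero off-diagonal entry.\<close>
  define v where "v = (if b \<noteq> 0 then of_gaps b (t - a) else of_gaps (t - d) c)"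
  have v: "v \<in> plane" by (simp add: v_def)
  have "gap1 v \<noteq> 0 \<or> gap2 v \<noteq> 0" using bc by (auto simp: v_def)
  then have "v \<noteq> 0" by (auto simp: gap1_def gap2_def)
  moreover have "word_act w v = t *\<^sub>R v"
    using m v t
    by (subst plane_eq_iff_gaps)
       (auto simp: word_act_in_plane plane_scaleR gap_matrix_def gaps_scaleR v_def algebra_simps)
  ultimately show "t \<in> eigenvalues_on plane (vecM_word w)"
    using v by (auto simp: eigenvalues_on_def vecM_word_eq_word_act)
qed

text \<open>A linear form with positive coefficients in the gaps, that is a left eigenvector; the
positivity is what makes its eigenvalue govern the growth of every vector of the cone.\<close>

definition left_eigen :: "nat list \<Rightarrow> real \<Rightarrow> bool" where
  "left_eigen w \<rho> \<longleftrightarrow> \<rho> > 0 \<and> (\<exists>x>0. \<exists>y>0. \<forall>v\<in>plane.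
     x * gap1 (word_act w v) + y * gap2 (word_act w v) = \<rho> * (x * gap1 v + y * gap2 v))"

text \<open>The discriminant $(a - d)^2 + 4bc$ is positive, so there are two real eigenvalues; their sum
and product are positive, hence so are they. The larger one is at least $a$ and at least $d$,
and the left eigenvector is $(\<rho> - d, b)$, or $(c, \<rho> - a)$ when $b = 0$. The clauses on
triangular matrices exclude that its coordinate with $\<rho>$ vanishes.\<close>

lemma perron_word:
  assumes m: "gap_matrix w a b c d" and e: "perron_entries a b c d"
  obtains \<rho> \<mu> where "0 < \<mu>" "\<mu> < \<rho>"
    "eigenvalues_on plane (vecM_word w) = {\<rho>, \<mu>}" "left_eigen w \<rho>"
proof -
  have e': "a > 0" "d > 0" "b \<ge> 0" "c \<ge> 0" "a * d > b * c"
    "b = 0 \<Longrightarrow> c > 0 \<and> d > a" "c = 0 \<Longrightarrow> b > 0 \<and> a > d"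
    using e by (auto simp: perron_entries_def)
  define D where "D = (a - d)\<^sup>2 + 4 * b * c"
  define r where "r = sqrt D"
  have bc0: "b * c \<ge> 0" using e' by simp
  have Dpos: "D > 0"
  proof (cases "b = 0 \<or> c = 0")
    case True
    then have "a \<noteq> d" using e' by auto
    then show ?thesis using True by (auto simp: D_def)
  next
    case False
    then have "b * c > 0" using e' by (simp add: order_less_le)
    then show ?thesis unfolding D_def by (simp add: add_nonneg_pos mult.assoc)
  qed
  then have r: "r > 0" "r * r = D" by (simp_all add: r_def)
  define \<rho> \<mu> where "\<rho> = (a + d + r) / 2" and "\<mu> = (a + d - r) / 2"
  have sum: "\<rho> + \<mu> = a + d" by (simp add: \<rho>_def \<mu>_def field_simps)
  have prod: "\<rho> * \<mu> = a * d - b * c"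
  proof -
    have "4 * (\<rho> * \<mu>) = (a + d)\<^sup>2 - r * r"
      by (simp add: \<rho>_def \<mu>_def power2_eq_square field_simps)
    also have "\<dots> = 4 * (a * d - b * c)"
      unfolding r(2) D_def by (simp add: power2_eq_square algebra_simps)
    finally show ?thesis by simp
  qed
  have less: "\<mu> < \<rho>" using r by (simp add: \<rho>_def \<mu>_def)
  have lpos: "\<rho> > 0" using e' r by (simp add: \<rho>_def)
  have mpos: "\<mu> > 0" using e'(5) zero_less_mult_pos[OF _ lpos, of \<mu>] by (simp add: prod)
  have "eigenvalues_on plane (vecM_word w) = {t. (a - t) * (d - t) = b * c}"
    using e' by (intro eigenvalues_gap_matrix[OF m]) auto
  also have "\<dots> = {t. (t - \<rho>) * (t - \<mu>) = 0}"
  proof -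
    have "(a - t) * (d - t) - b * c = (t - \<rho>) * (t - \<mu>)" for t
      using sum prod by algebra
    then have "(a - t) * (d - t) = b * c \<longleftrightarrow> (t - \<rho>) * (t - \<mu>) = 0" for t
      by (simp only: eq_iff_diff_eq_0[of _ "b * c"])
    then show ?thesis by blast
  qed
  also have "\<dots> = {\<rho>, \<mu>}" by auto
  finally have eig: "eigenvalues_on plane (vecM_word w) = {\<rho>, \<mu>}" .
  have char: "(\<rho> - a) * (\<rho> - d) = b * c" using sum prod by algebra
  have ge: "\<rho> \<ge> a" "\<rho> \<ge> d"
  proof -
    have "\<bar>a - d\<bar> \<le> r"
      unfolding r_def D_def using bc0 by (intro real_le_rsqrt) simp
    then show "\<rho> \<ge> a" "\<rho> \<ge> d" by (auto simp: \<rho>_def)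
  qed
  have "\<exists>x>0. \<exists>y>0. x * a + y * c = \<rho> * x \<and> x * b + y * d = \<rho> * y"
  proof (cases "b = 0")
    case True
    then have "\<rho> - a > 0" using e' ge by auto
    moreover have "c > 0" using True e' by auto
    ultimately show ?thesis using char True
      by (intro exI[of _ c] conjI exI[of _ "\<rho> - a"]) (auto simp: algebra_simps)
  next
    case False
    have "\<rho> \<noteq> d" using char e' False ge by auto
    then have "\<rho> - d > 0" using ge by simp
    moreover have "b > 0" using False e' by auto
    ultimately show ?thesis using char
      by (intro exI[of _ "\<rho> - d"] conjI exI[of _ b]) (auto simp: algebra_simps)
  qed
  then obtain x y where xy: "x > 0" "y > 0" "x * a + y * c = \<rho> * x" "x * b + y * d = \<rho> * y"
    by blast
  have "x * gap1 (word_act w v) + y * gap2 (word_act w v) = \<rho> * (x * gap1 v + y * gap2 v)"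
    if "v \<in> plane" for v
  proof -
    have "x * gap1 (word_act w v) + y * gap2 (word_act w v)
        = (x * a + y * c) * gap1 v + (x * b + y * d) * gap2 v"
      using m that by (simp add: gap_matrix_def algebra_simps)
    then show ?thesis unfolding xy by (simp add: algebra_simps)
  qed
  then have "left_eigen w \<rho>" using lpos xy by (auto simp: left_eigen_def)
  then show thesis by (rule that[OF mpos less eig])
qed

lemma perron_word_Max:
  assumes "w \<noteq> []"
  shows "card (eigenvalues_on plane (vecM_word w)) = 2"
    and "\<forall>c\<in>eigenvalues_on plane (vecM_word w). c > 0"
    and "left_eigen w (Max (eigenvalues_on plane (vecM_word w)))"
proof -
  obtain a b c d where "gap_matrix w a b c d" "perron_entries a b c d"
    using gap_matrix_nonempty[OF assms] by blast
  then obtain \<rho> \<mu> where "0 < \<mu>" "\<mu> < \<rho>"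
    "eigenvalues_on plane (vecM_word w) = {\<rho>, \<mu>}" "left_eigen w \<rho>"
    by (rule perron_word)
  then show "card (eigenvalues_on plane (vecM_word w)) = 2"
    "\<forall>c\<in>eigenvalues_on plane (vecM_word w). c > 0"
    "left_eigen w (Max (eigenvalues_on plane (vecM_word w)))"
    by (auto simp: max_def)
qed

lemma gap_matrix_unique:
  assumes "gap_matrix w a b c d" "gap_matrix w a' b' c' d'"
  shows "a = a'" "b = b'" "c = c'" "d = d'"
proof -
  have "a * x + b * y = a' * x + b' * y" "c * x + d * y = c' * x + d' * y" for x y
    using assms by (auto simp: gap_matrix_def dest!: bspec[of plane _ "of_gaps x y"])
  from this[of 1 0] this[of 0 1] show "a = a'" "b = b'" "c = c'" "d = d'" by simp_all
qed

lemma Max_eigenvalue_triangular: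
  assumes "w \<noteq> []" and m: "gap_matrix w a b c d" and bc: "b * c = 0"
  shows "Max (eigenvalues_on plane (vecM_word w)) = max a d"
proof -
  obtain a' b' c' d' where m': "gap_matrix w a' b' c' d'" and "perron_entries a' b' c' d'"
    using gap_matrix_nonempty[OF assms(1)] by blast
  then have "b \<noteq> 0 \<or> c \<noteq> 0"
    using gap_matrix_unique[OF m m'] by (auto simp: perron_entries_def)
  then have "eigenvalues_on plane (vecM_word w) = {a, d}"
    using eigenvalues_gap_matrix[OF m] bc by auto
  then show ?thesis by simp
qed

text \<open>These two words are the periods of the two expansions of a dyadic number. That they have
the same larger eigenvalue makes the exponents on the two sides of that number agree.\<close>

lemma Max_eigenvalue_replicate:
  assumes "n \<ge> 1"
  shows "Max (eigenvalues_on plane (vecM_word (replicate n 0))) = (3/5)^n"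
    and "Max (eigenvalues_on plane (vecM_word (replicate n 1))) = (3/5)^n"
proof -
  have ne: "replicate n i \<noteq> []" for i :: nat using assms by auto
  have le: "(1/5)^n \<le> (3/5 :: real)^n" by (intro power_mono) auto
  obtain b where "gap_matrix (replicate n 0) ((3/5)^n) b 0 ((1/5)^n)"
    using gap_matrix_replicate_zero by blast
  from Max_eigenvalue_triangular[OF ne this] le
  show "Max (eigenvalues_on plane (vecM_word (replicate n 0))) = (3/5)^n" by simp
  obtain c where "gap_matrix (replicate n 1) ((1/5)^n) 0 c ((3/5)^n)"
    using gap_matrix_replicate_one by blast
  from Max_eigenvalue_triangular[OF ne this] le
  show "Max (eigenvalues_on plane (vecM_word (replicate n 1))) = (3/5)^n" by simp
qed

section \<open>The curve increases for the cone of ordered vectors\<close>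

definition gap_cone :: "(real^3) set" where
  "gap_cone = {v \<in> plane. 0 \<le> gap1 v \<and> 0 \<le> gap2 v}"

text \<open>On the cone the spread is a substitute for the norm that is linear and non-negative, hence
monotone along the curve.\<close>

definition spread :: "real^3 \<Rightarrow> real" where
  "spread v = gap1 v + gap2 v"

lemma spread_diff: "spread (v - w) = spread v - spread w"
  by (simp add: spread_def gaps_diff)

lemma cone_add: "v \<in> gap_cone \<Longrightarrow> w \<in> gap_cone \<Longrightarrow> v + w \<in> gap_cone"
  by (simp add: gap_cone_def plane_def gap1_def gap2_def)

lemma word_act_in_cone: "v \<in> gap_cone \<Longrightarrow> word_act w v \<in> gap_cone"
proof (induction w)
  case (Cons i w)
  then show ?case by (simp add: gap_cone_def M_in_plane gaps_M)
qed simp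

text \<open>In gap coordinates the column sums of the two matrices are 2/5 and 3/5. So the prefix of an
expansion changes the spread of an increment by a bounded factor only.\<close>

lemma spread_word_act:
  assumes "v \<in> gap_cone"
  shows "(2/5) ^ length w * spread v \<le> spread (word_act w v)"
    and "spread (word_act w v) \<le> spread v"
proof -
  have step: "2/5 * spread v \<le> spread (M i *v v)" "spread (M i *v v) \<le> spread v"
    if "v \<in> gap_cone" for v i
    using that by (auto simp: gap_cone_def spread_def gaps_M field_simps)
  show "(2/5) ^ length w * spread v \<le> spread (word_act w v)"
  proof (induction w)
    case (Cons i w)
    then show ?case using step(1)[OF word_act_in_cone[OF assms], of w i] by simp
  qed simp
  show "spread (word_act w v) \<le> spread v"
    using step(2)[OF word_act_in_cone[OF assms]] by (induction w) (auto intro: order_trans)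
qed

text \<open>On the cone, a linear form with positive coefficients $x$, $y$ lies between $\min(x, y)$ and
$\max(x, y)$ times the spread. The left eigenvector is such a form and is multiplied by exactly
$\<rho>$ under the word.\<close>

lemma left_eigen_growth:
  assumes "left_eigen w \<rho>"
  obtains c C where "0 < c"
    "\<And>j v. v \<in> gap_cone \<Longrightarrow> c * \<rho> ^ j * spread v \<le> spread (word_act (concat (replicate j w)) v)"
    "\<And>j v. v \<in> gap_cone \<Longrightarrow> spread (word_act (concat (replicate j w)) v) \<le> C * \<rho> ^ j * spread v"
proof -
  from assms obtain x y where l: "\<rho> > 0" and xy: "x > 0" "y > 0"
    and inv: "\<And>v. v \<in> plane \<Longrightarrow> x * gap1 (word_act w v) + y * gap2 (word_act w v)
      = \<rho> * (x * gap1 v + y * gap2 v)"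
    by (auto simp: left_eigen_def)
  define f where "f v = x * gap1 v + y * gap2 v" for v
  define A B where "A = min x y" and "B = max x y"
  have AB: "A > 0" "B > 0" using xy by (auto simp: A_def B_def)
  have cmp: "A * spread v \<le> f v" "f v \<le> B * spread v" if "v \<in> gap_cone" for v
    using that unfolding gap_cone_def f_def spread_def distrib_left
    by (auto intro!: add_mono mult_right_mono simp: A_def B_def)
  have pow: "f (word_act (concat (replicate j w)) v) = \<rho> ^ j * f v" if "v \<in> plane" for j v
    using that by (induction j) (simp_all add: word_act_append f_def inv word_act_in_plane)
  \<comment> \<open>Passing from the spread to the form and back costs one factor $A$ and one factor $B$.\<close>
  have "A / B * \<rho> ^ j * spread v \<le> spread (word_act (concat (replicate j w)) v)"
    "spread (word_act (concat (replicate j w)) v) \<le> B / A * \<rho> ^ j * spread v"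
    if v: "v \<in> gap_cone" for j v
  proof -
    let ?v = "word_act (concat (replicate j w)) v"
    have c: "?v \<in> gap_cone" by (rule word_act_in_cone[OF v])
    have eq: "f ?v = \<rho> ^ j * f v" using pow v by (simp add: gap_cone_def)
    have "\<rho> ^ j * (A * spread v) \<le> \<rho> ^ j * f v" "\<rho> ^ j * f v \<le> \<rho> ^ j * (B * spread v)"
      using cmp[OF v] l by (auto intro!: mult_left_mono)
    with cmp[OF c] eq have "\<rho> ^ j * (A * spread v) \<le> B * spread ?v"
      "A * spread ?v \<le> \<rho> ^ j * (B * spread v)" by auto
    then show "A / B * \<rho> ^ j * spread v \<le> spread ?v"
      "spread ?v \<le> B / A * \<rho> ^ j * spread v"
      using AB by (simp_all add: field_simps)
  qed
  then show thesis using AB by (intro that[of "A / B" "B / A"]) auto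
qed

lemma curve_word_map:
  assumes "is_curve u" "x \<in> {0..1}"
  shows "u (word_map w x) = word_act w (u x)"
  using assms
proof (induction w)
  case (Cons i w)
  then show ?case using word_map_in_unit[of x w] by (simp add: is_curve_def M_def)
qed simp

text \<open>An interval on one side of 1/2 is the image of a coarser dyadic interval under one of the two
contractions, whose matrix preserves the cone. An interval containing 1/2 is cut there, and the
cone is closed under addition.\<close>

lemma curve_dyadic_increment:
  assumes u: "is_curve u"
  shows "i \<le> j \<Longrightarrow> j \<le> 2 ^ m \<Longrightarrow> u (real j / 2 ^ m) - u (real i / 2 ^ m) \<in> gap_cone"
proof (induction m arbitrary: i j)
  case 0
  then have "i = 0 \<and> j = 0 \<or> i = 0 \<and> j = 1 \<or> i = 1 \<and> j = 1" by auto
  then show ?case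
    using u by (auto simp: is_curve_def gap_cone_def plane_def gap1_def gap2_def)
next
  case (Suc m)
  have half: "u (real j / 2 ^ Suc m) - u (real i / 2 ^ Suc m) \<in> gap_cone"
    if "i \<le> j" "j \<le> 2 ^ m" for i j
  proof -
    have eq: "real l / 2 ^ Suc m = word_map [0] (real l / 2 ^ m)" for l
      by (simp add: h0_def)
    have "real i / 2 ^ m \<in> {0..1}" "real j / 2 ^ m \<in> {0..1}"
      using that by (auto simp: divide_le_eq_1)
    then show ?thesis
      unfolding eq using Suc.IH[OF that]
      by (simp only: curve_word_map[OF u] word_act_diff[symmetric] word_act_in_cone)
  qed
  have half': "u (real j / 2 ^ Suc m) - u (real i / 2 ^ Suc m) \<in> gap_cone"
    if "2 ^ m \<le> i" "i \<le> j" "j \<le> 2 ^ Suc m" for i j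
  proof -
    have eq: "real l / 2 ^ Suc m = word_map [1] (real (l - 2 ^ m) / 2 ^ m)" if "2 ^ m \<le> l" for l
      using that by (simp add: h1_def of_nat_diff field_simps)
    have "real (i - 2 ^ m) / 2 ^ m \<in> {0..1}" "real (j - 2 ^ m) / 2 ^ m \<in> {0..1}"
      using that of_nat_mono[OF that(3), where 'a = real] of_nat_mono[OF that(2), where 'a = real]
      by (auto simp: divide_le_eq_1 of_nat_diff)
    then show ?thesis
      unfolding eq[OF that(1)] eq[OF order_trans[OF that(1,2)]]
      using Suc.IH[of "i - 2 ^ m" "j - 2 ^ m"] that
      by (simp add: curve_word_map[OF u] word_act_diff[symmetric] word_act_in_cone
               del: word_map_simps word_act_simps)
  qed
  consider "j \<le> 2 ^ m" | "2 ^ m \<le> i" | "i \<le> 2 ^ m" "2 ^ m \<le> j" by linarith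
  then show ?case
  proof cases
    case 3
    have "u (real j / 2 ^ Suc m) - u (real i / 2 ^ Suc m) =
      (u (real j / 2 ^ Suc m) - u (real (2 ^ m) / 2 ^ Suc m))
      + (u (real (2 ^ m) / 2 ^ Suc m) - u (real i / 2 ^ Suc m))"
      by simp
    then show ?thesis
      using cone_add[OF half'[OF order_refl 3(2) Suc.prems(2)] half[OF 3(1) order_refl]]
      by simp
  qed (use Suc.prems half half' in auto)
qed

lemma dyadic_truncation_tendsto: "(\<lambda>m. real (nat \<lfloor>2 ^ m * x\<rfloor>) / 2 ^ m) \<longlonglongrightarrow> x" if "0 \<le> x"
proof -
  have bound: "\<bar>real (nat \<lfloor>2 ^ m * x\<rfloor>) / 2 ^ m - x\<bar> \<le> (1/2) ^ m" for m
  proof -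
    have eq: "real (nat \<lfloor>2 ^ m * x\<rfloor>) = of_int \<lfloor>2 ^ m * x\<rfloor>" using that by simp
    have "\<bar>of_int \<lfloor>2 ^ m * x\<rfloor> - 2 ^ m * x\<bar> \<le> 1" by linarith
    then have "\<bar>of_int \<lfloor>2 ^ m * x\<rfloor> - 2 ^ m * x\<bar> / 2 ^ m \<le> 1 / 2 ^ m"
      by (intro divide_right_mono) auto
    moreover have "of_int \<lfloor>2 ^ m * x\<rfloor> / 2 ^ m - x = (of_int \<lfloor>2 ^ m * x\<rfloor> - 2 ^ m * x) / 2 ^ m"
      by (simp add: diff_divide_distrib)
    ultimately show ?thesis by (simp add: eq abs_divide power_one_over)
  qed
  have "(\<lambda>m. (1/2 :: real) ^ m) \<longlonglongrightarrow> 0" by (intro LIMSEQ_power_zero) simp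
  then have "(\<lambda>m. real (nat \<lfloor>2 ^ m * x\<rfloor>) / 2 ^ m - x) \<longlonglongrightarrow> 0"
    by (rule Lim_null_comparison[rotated]) (simp add: bound)
  then show ?thesis by (simp add: LIM_zero_iff)
qed

lemma closed_gap_cone: "closed gap_cone"
proof -
  have "gap_cone = {v. v $ 1 + v $ 2 + v $ 3 = 0} \<inter> {v. v $ 1 \<le> v $ 3} \<inter> {v. v $ 3 \<le> v $ 2}"
    by (auto simp: gap_cone_def plane_def gap1_def gap2_def)
  then show ?thesis
    by (elim ssubst) (intro closed_Int closed_Collect_eq closed_Collect_le continuous_intros)
qed

text \<open>By continuity of the curve, since the cone is closed and the dyadic numbers are dense.\<close>

lemma curve_increment_in_cone:
  assumes u: "is_curve u" and "0 \<le> s" "s \<le> t" "t \<le> 1"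
  shows "u t - u s \<in> gap_cone"
proof -
  let ?d = "\<lambda>m x. real (nat \<lfloor>2 ^ m * x\<rfloor>) / 2 ^ m"
  have lim: "(\<lambda>m. u (?d m x)) \<longlonglongrightarrow> u x" if x: "x \<in> {0..1}" for x
  proof (rule continuous_on_tendsto_compose[of "{0..1}" u])
    have "\<lfloor>2 ^ m * x\<rfloor> \<le> \<lfloor>2 ^ m :: real\<rfloor>" for m using x by (intro floor_mono) simp
    then have "nat \<lfloor>2 ^ m * x\<rfloor> \<le> 2 ^ m" for m by (simp add: nat_le_iff)
    then have "real (nat \<lfloor>2 ^ m * x\<rfloor>) \<le> 2 ^ m" for m
      by (metis of_nat_le_iff of_nat_numeral of_nat_power)
    then show "\<forall>\<^sub>F m in sequentially. ?d m x \<in> {0..1}" by (auto simp: divide_le_eq_1)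
  qed (use u x dyadic_truncation_tendsto in \<open>auto simp: is_curve_def\<close>)
  have "u (?d m t) - u (?d m s) \<in> gap_cone" for m
  proof (rule curve_dyadic_increment[OF u])
    show "nat \<lfloor>2 ^ m * s\<rfloor> \<le> nat \<lfloor>2 ^ m * t\<rfloor>" using assms by (intro nat_mono floor_mono) simp
    have "\<lfloor>2 ^ m * t\<rfloor> \<le> \<lfloor>2 ^ m :: real\<rfloor>" using assms by (intro floor_mono) simp
    then show "nat \<lfloor>2 ^ m * t\<rfloor> \<le> 2 ^ m" by (simp add: nat_le_iff)
  qed
  moreover have "(\<lambda>m. u (?d m t) - u (?d m s)) \<longlonglongrightarrow> u t - u s"
    using assms by (intro tendsto_diff lim) auto
  ultimately show ?thesis by (rule closed_sequentially[OF closed_gap_cone])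
qed

lemma spread_curve_mono:
  assumes "is_curve u" "0 \<le> s" "s \<le> t" "t \<le> 1"
  shows "spread (u s) \<le> spread (u t)"
proof -
  have "0 \<le> spread (u t - u s)"
    using curve_increment_in_cone[OF assms] by (auto simp: gap_cone_def spread_def)
  then show ?thesis by (simp add: spread_diff)
qed

text \<open>The interval between $x$ and the endpoint contains the image of [0, 1] under $0^m$ or $1^m$
for large $m$. The increment over such an image is that over [0, 1] transformed by the word, and its spread
does not vanish by \<open>spread_word_act\<close>.\<close>

lemma spread_curve_endpoints:
  assumes u: "is_curve u" and x: "x \<in> {0..1}"
  shows "x > 0 \<Longrightarrow> spread (u 0) < spread (u x)" and "x < 1 \<Longrightarrow> spread (u x) < spread (u 1)"
proof -
  have word: "spread (u (word_map w 0)) < spread (u (word_map w 1))" for w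
  proof -
    have c: "u 1 - u 0 \<in> gap_cone" by (rule curve_increment_in_cone[OF u]) auto
    have "u 0 = vector [1, 0, 0]" "u 1 = vector [0, 1, 0]" using u by (simp_all only: is_curve_def)
    then have "spread (u 1 - u 0) > 0" by (simp add: spread_def gap1_def gap2_def)
    then have "0 < (2/5) ^ length w * spread (u 1 - u 0)" by simp
    also have "\<dots> \<le> spread (word_act w (u 1 - u 0))" by (rule spread_word_act[OF c])
    also have "\<dots> = spread (u (word_map w 1)) - spread (u (word_map w 0))"
      by (simp add: curve_word_map[OF u] word_act_diff spread_diff)
    finally show ?thesis by simp
  qed
  have small: "\<exists>m. (1/2 :: real) ^ m < y" if "y > 0" for y
    using real_arch_pow_inv[OF that, of "1/2"] by simp
  have len: "word_map w 1 - word_map w 0 = (1/2) ^ length w" for w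
    using word_map_diff[of w 1 0] by (simp add: power_one_over)
  note zero = word_map_replicate(1) and one = word_map_replicate(2)
  show "spread (u 0) < spread (u x)" if "x > 0"
  proof -
    obtain m where "(1/2 :: real) ^ m < x" using small \<open>x > 0\<close> by blast
    then have "word_map (replicate m 0) 1 \<le> x" using len[of "replicate m 0"] zero[of m] by simp
    then have "spread (u (word_map (replicate m 0) 1)) \<le> spread (u x)"
      using x word_map_in_unit[of 1] by (intro spread_curve_mono[OF u]) auto
    then show ?thesis using word[of "replicate m 0"] zero[of m] by simp
  qed
  show "spread (u x) < spread (u 1)" if "x < 1"
  proof -
    obtain m where "(1/2 :: real) ^ m < 1 - x" using small[of "1 - x"] \<open>x < 1\<close> by auto
    then have "x \<le> word_map (replicate m 1) 0" using len[of "replicate m 1"] one[of m] by simp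
    then have "spread (u x) \<le> spread (u (word_map (replicate m 1) 0))"
      using x word_map_in_unit[of 0] by (intro spread_curve_mono[OF u]) auto
    then show ?thesis using word[of "replicate m 1"] one[of m] by simp
  qed
qed

section \<open>From logarithmic growth to the exponent\<close>

text \<open>Choose $j$ with $r q^{j+1} \<le> x \<le> r q^j$. Then monotonicity puts $\ln g(x)$ at bounded
distance from $j \ln \<rho>$, while $\ln x$ is at bounded distance from $j \ln q$; eliminating $j$
gives the exponent $\ln \<rho> / \ln q$.\<close>

lemma log_growth_of_geometric_samples:
  fixes g :: "real \<Rightarrow> real"
  assumes q: "0 < q" "q < 1" and pos: "0 < \<rho>" "0 < r" "0 < c"
    and mono: "\<And>x y. 0 < x \<Longrightarrow> x \<le> y \<Longrightarrow> y \<le> r \<Longrightarrow> g x \<le> g y"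
    and lower: "\<And>j. c * \<rho> ^ j \<le> g (r * q ^ j)"
    and upper: "\<And>j. g (r * q ^ j) \<le> C * \<rho> ^ j"
  shows "\<exists>B. \<forall>x. 0 < x \<and> x \<le> r \<longrightarrow> 0 < g x \<and> \<bar>ln (g x) - ln \<rho> / ln q * ln x\<bar> \<le> B"
proof -
  define e where "e = ln \<rho> / ln q"
  have lq: "ln q < 0" using q by simp
  have le: "e * ln q = ln \<rho>" using lq by (simp add: e_def)
  have "c \<le> C" using lower[of 0] upper[of 0] by simp
  then have Cpos: "C > 0" using pos by simp
  have "0 < g x \<and> \<bar>ln (g x) - e * ln x\<bar> \<le> \<bar>ln c\<bar> + \<bar>ln \<rho>\<bar> + \<bar>ln C\<bar> + \<bar>e\<bar> * (\<bar>ln r\<bar> + \<bar>ln q\<bar>)"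
    if x: "0 < x" "x \<le> r" for x
  proof -
    \<comment> \<open>Both logarithms are non-positive, so the quotient is non-negative and its floor is a natural number.\<close>
    define j where "j = nat \<lfloor>ln (x / r) / ln q\<rfloor>"
    have "ln (x / r) \<le> 0" using x pos by simp
    then have nn: "0 \<le> ln (x / r) / ln q" using lq by (simp add: divide_nonpos_neg)
    then have "real j \<le> ln (x / r) / ln q" "ln (x / r) / ln q \<le> real j + 1"
      unfolding j_def by linarith+
    then have "ln (x / r) \<le> real j * ln q" "(real j + 1) * ln q \<le> ln (x / r)"
      using lq by (simp_all add: neg_divide_le_eq neg_le_divide_eq mult.commute)
    then have lx: "ln x \<le> ln r + real j * ln q" "ln r + real j * ln q + ln q \<le> ln x"
      using x pos by (simp_all add: ln_div algebra_simps)
    have "x \<le> r * q ^ j" "r * q ^ Suc j \<le> x"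
    proof -
      have "ln x \<le> ln (r * q ^ j)" "ln (r * q ^ Suc j) \<le> ln x"
        using lx q pos by (simp_all add: ln_mult ln_realpow algebra_simps)
      then show "x \<le> r * q ^ j" "r * q ^ Suc j \<le> x"
        using x q pos by (simp_all add: ln_le_cancel_iff)
    qed
    moreover have "r * q ^ j \<le> r" "0 < r * q ^ Suc j"
      using q pos by (simp_all add: power_le_one mult_le_cancel_left1)
    ultimately have "c * \<rho> ^ Suc j \<le> g x" "g x \<le> C * \<rho> ^ j"
      using order_trans[OF lower mono, of "Suc j" x] order_trans[OF mono upper, of x j] x by auto
    moreover have cj: "0 < c * \<rho> ^ Suc j" using pos by simp
    ultimately have gpos: "0 < g x" by linarith
    with cj \<open>c * \<rho> ^ Suc j \<le> g x\<close> \<open>g x \<le> C * \<rho> ^ j\<close>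
    have "ln (c * \<rho> ^ Suc j) \<le> ln (g x)" "ln (g x) \<le> ln (C * \<rho> ^ j)"
      by (simp_all only: ln_mono)
    then have lg: "ln c + real j * ln \<rho> + ln \<rho> \<le> ln (g x)" "ln (g x) \<le> ln C + real j * ln \<rho>"
      using pos Cpos by (simp_all add: ln_mult ln_realpow algebra_simps)
    have "\<bar>ln (g x) - real j * ln \<rho>\<bar> \<le> \<bar>ln c\<bar> + \<bar>ln \<rho>\<bar> + \<bar>ln C\<bar>"
      using lg by linarith
    moreover have "\<bar>e * (ln x - real j * ln q)\<bar> \<le> \<bar>e\<bar> * (\<bar>ln r\<bar> + \<bar>ln q\<bar>)"
      unfolding abs_mult using lx by (intro mult_left_mono) linarith+
    moreover have "e * (ln x - real j * ln q) = e * ln x - real j * ln \<rho>"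
      by (simp add: algebra_simps flip: le)
    ultimately show ?thesis using gpos by linarith
  qed
  then show ?thesis unfolding e_def by blast
qed

text \<open>The vectors of the cone with spread 1 form a segment that avoids the origin. A norm is
continuous and positive on this compact segment, so it lies between two positive constants
there; homogeneity extends the bounds to the cone.\<close>

lemma norm_comparable_to_spread:
  assumes N: "is_norm N"
  obtains c C where "0 < c" "\<And>v. v \<in> gap_cone \<Longrightarrow> c * spread v \<le> N v"
    "\<And>v. v \<in> gap_cone \<Longrightarrow> N v \<le> C * spread v"
proof -
  have N0: "0 \<le> N x" "N x = 0 \<longleftrightarrow> x = 0" "N (a *\<^sub>R x) = \<bar>a\<bar> * N x" "N (x + y) \<le> N x + N y" for x y a
    using N by (auto simp: is_norm_def)
  define g where "g x = N (of_gaps x (1 - x))" for x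
  define L where "L = N (of_gaps 1 (- 1))"
  have lip: "g x \<le> g y + L * \<bar>x - y\<bar>" for x y
  proof -
    have "of_gaps x (1 - x) = of_gaps y (1 - y) + (x - y) *\<^sub>R of_gaps 1 (- 1)"
      by (simp add: of_gaps_def vec_eq_iff forall_3 field_simps)
    then show ?thesis
      using N0(4)[of "of_gaps y (1 - y)" "(x - y) *\<^sub>R of_gaps 1 (- 1)"] N0(3)
      by (simp add: g_def L_def mult.commute)
  qed
  have "L-lipschitz_on {0..1} g"
  proof (rule lipschitz_onI)
    show "dist (g x) (g y) \<le> L * dist x y" for x y
      using lip[of x y] lip[of y x] by (simp add: dist_real_def abs_le_iff abs_minus_commute)
  qed (simp add: L_def N0(1))
  then have cont: "continuous_on {0..1} g" by (rule lipschitz_on_continuous_on)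
  have "\<exists>x0\<in>{0..1}. \<forall>x\<in>{0..1}. g x0 \<le> g x"
    by (rule continuous_attains_inf[OF _ _ cont]) auto
  then obtain x0 where x0: "\<And>x. x \<in> {0..1} \<Longrightarrow> g x0 \<le> g x"
    by blast
  have "\<exists>x1\<in>{0..1}. \<forall>x\<in>{0..1}. g x \<le> g x1"
    by (rule continuous_attains_sup[OF _ _ cont]) auto
  then obtain x1 where x1: "\<And>x. x \<in> {0..1} \<Longrightarrow> g x \<le> g x1"
    by blast
  have "of_gaps x0 (1 - x0) \<noteq> 0"
  proof
    assume "of_gaps x0 (1 - x0) = 0"
    then have "gap1 (of_gaps x0 (1 - x0)) = 0" "gap2 (of_gaps x0 (1 - x0)) = 0"
      by (simp_all only: gap1_def gap2_def) simp_all
    then show False by simp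
  qed
  then have c: "0 < g x0" unfolding g_def using N0(1,2) by (simp add: order_less_le)
  have "g x0 * spread v \<le> N v \<and> N v \<le> g x1 * spread v" if v: "v \<in> gap_cone" for v
  proof -
    have cone: "v \<in> plane" "0 \<le> gap1 v" "0 \<le> gap2 v" using v by (auto simp: gap_cone_def)
    define S where "S = spread v"
    show ?thesis
    proof (cases "S = 0")
      case True
      then have "gap1 v = 0" "gap2 v = 0" using cone by (auto simp: S_def spread_def)
      then have "v = of_gaps 0 0" using of_gaps_gaps[OF cone(1)] by simp
      also have "\<dots> = 0" by (simp add: of_gaps_def vec_eq_iff forall_3)
      finally have "N v = 0" using N0(2) by simp
      then show ?thesis using True by (simp add: S_def)
    next
      case False
      then have S: "S > 0" using cone by (simp add: S_def spread_def)
      define x where "x = gap1 v / S"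
      have x: "x \<in> {0..1}" "gap1 v = S * x" "gap2 v = S * (1 - x)"
        using cone S by (auto simp: x_def S_def spread_def field_simps)
      have "v = of_gaps (S * x) (S * (1 - x))" using of_gaps_gaps[OF cone(1)] x by simp
      also have "\<dots> = S *\<^sub>R of_gaps x (1 - x)"
        by (simp add: of_gaps_def vec_eq_iff forall_3 field_simps)
      finally have "N v = S * g x" using S N0(3) by (simp add: g_def)
      then show ?thesis
        using x0[OF x(1)] x1[OF x(1)] S by (simp add: mult.commute flip: S_def)
    qed
  qed
  then show thesis using c by (intro that[of "g x0" "g x1"]) auto
qed

text \<open>The endpoint $\<tau>$ selects the side: the parameters considered are $t = s + \<theta> (\<tau> -
\<sigma>)$ with $\<theta>$ positive and small. As a function of $\<theta>$, the spread of the increment is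
monotone, and the words $w p^j$ give its values along a geometric sequence.\<close>

lemma one_sided_log_growth:
  assumes u: "is_curve u" and N: "is_norm N"
    and p: "p \<noteq> []" "left_eigen p \<rho>"
    and \<sigma>: "\<sigma> \<in> {0..1}" "word_map p \<sigma> = \<sigma>" and \<tau>: "\<tau> \<in> {0, 1}" "\<tau> \<noteq> \<sigma>"
    and s: "s = word_map w \<sigma>"
  shows "\<exists>r>0. \<exists>B. \<forall>t. 0 < (t - s) * (\<tau> - \<sigma>) \<and> \<bar>t - s\<bar> \<le> r \<longrightarrow>
    \<bar>ln (N (u t - u s)) - ln \<rho> / (real (length p) * ln (1/2)) * ln \<bar>t - s\<bar>\<bar> \<le> B"
proof -
  define r q :: real where "r = (1/2) ^ length w" and "q = (1/2) ^ length p"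
  \<comment> \<open>The increment is oriented so that it lies in the cone on either side of \<open>\<sigma>\<close>.\<close>
  define v where "v = (if \<sigma> < \<tau> then u \<tau> - u \<sigma> else u \<sigma> - u \<tau>)"
  define g where "g \<theta> = \<bar>spread (u (s + \<theta> * (\<tau> - \<sigma>))) - spread (u s)\<bar>" for \<theta>
  have \<tau>01: "\<tau> \<in> {0..1}" using \<tau> by auto
  have s01: "s \<in> {0..1}" unfolding s by (rule word_map_in_unit[OF \<sigma>(1)])
  have in_unit: "s + \<theta> * (\<tau> - \<sigma>) \<in> {0..1}" if "0 < \<theta>" "\<theta> \<le> r" for \<theta>
  proof -
    have "s + r * (\<tau> - \<sigma>) = word_map w \<tau>"
      using word_map_diff[of w \<tau> \<sigma>] by (simp add: s r_def power_one_over field_simps)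
    then have "s + r * (\<tau> - \<sigma>) \<in> {0..1}" using word_map_in_unit[OF \<tau>01] by simp
    moreover have "0 \<le> \<theta> * (\<tau> - \<sigma>) \<and> \<theta> * (\<tau> - \<sigma>) \<le> r * (\<tau> - \<sigma>)
        \<or> r * (\<tau> - \<sigma>) \<le> \<theta> * (\<tau> - \<sigma>) \<and> \<theta> * (\<tau> - \<sigma>) \<le> 0"
      using that by (cases "\<sigma> < \<tau>")
        (auto intro!: mult_right_mono mult_right_mono_neg mult_nonneg_nonpos)
    ultimately show ?thesis using s01 unfolding atLeastAtMost_iff by linarith
  qed
  have order: "if \<sigma> < \<tau> then s \<le> s + \<theta> * (\<tau> - \<sigma>) \<and> s + \<theta> * (\<tau> - \<sigma>) \<le> s + \<theta>' * (\<tau> - \<sigma>)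
    else s + \<theta> * (\<tau> - \<sigma>) \<le> s \<and> s + \<theta>' * (\<tau> - \<sigma>) \<le> s + \<theta> * (\<tau> - \<sigma>)"
    if "0 < \<theta>" "\<theta> \<le> \<theta>'" for \<theta> \<theta>'
    using that by (auto intro!: mult_right_mono mult_right_mono_neg mult_nonneg_nonpos)
  have mono: "g \<theta> \<le> g \<theta>'" if "0 < \<theta>" "\<theta> \<le> \<theta>'" "\<theta>' \<le> r" for \<theta> \<theta>'
  proof -
    define x y where "x = s + \<theta> * (\<tau> - \<sigma>)" and "y = s + \<theta>' * (\<tau> - \<sigma>)"
    have "x \<in> {0..1}" "y \<in> {0..1}" unfolding x_def y_def using that by (intro in_unit; simp)+
    moreover have "s \<le> x \<and> x \<le> y \<or> x \<le> s \<and> y \<le> x"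
      using order[OF that(1,2)] by (auto simp: x_def y_def split: if_splits)
    ultimately have "spread (u s) \<le> spread (u x) \<and> spread (u x) \<le> spread (u y)
      \<or> spread (u x) \<le> spread (u s) \<and> spread (u y) \<le> spread (u x)"
      using s01 spread_curve_mono[OF u] by auto
    then show ?thesis unfolding g_def x_def[symmetric] y_def[symmetric] by linarith
  qed
  have vc: "v \<in> gap_cone"
    using \<sigma>(1) \<tau>01 by (auto simp: v_def intro!: curve_increment_in_cone[OF u])
  have vpos: "0 < spread v"
    using spread_curve_endpoints[OF u \<sigma>(1)] \<sigma>(1) \<tau> by (auto simp: v_def spread_diff)
  have sample: "g (r * q ^ j) = spread (word_act (w @ concat (replicate j p)) v)" for j
  proof -
    let ?W = "w @ concat (replicate j p)"
    have W\<sigma>: "word_map ?W \<sigma> = s"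
    proof -
      have "word_map (concat (replicate j p)) \<sigma> = \<sigma>"
        by (induction j) (simp_all add: word_map_append \<sigma>(2))
      then show ?thesis by (simp add: word_map_append s)
    qed
    have "length ?W = length w + length p * j" by (induction j) simp_all
    then have len: "(2 :: real) ^ length ?W = 2 ^ length w * (2 ^ length p) ^ j"
      by (simp add: power_add power_mult)
    have at: "s + r * q ^ j * (\<tau> - \<sigma>) = word_map ?W \<tau>"
      using word_map_diff[of ?W \<tau> \<sigma>] unfolding W\<sigma> len r_def q_def
      by (simp add: power_one_over field_simps)
    have "u (word_map ?W \<tau>) - u s = word_act ?W (u \<tau> - u \<sigma>)"
      by (simp only: curve_word_map[OF u \<tau>01] curve_word_map[OF u \<sigma>(1)] word_act_diff flip: W\<sigma>)
    then have g: "g (r * q ^ j) = \<bar>spread (word_act ?W (u \<tau> - u \<sigma>))\<bar>"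
      unfolding g_def at by (simp only: spread_diff[symmetric])
    have "word_act ?W v \<in> gap_cone" by (rule word_act_in_cone[OF vc])
    then have "0 \<le> spread (word_act ?W v)" by (simp add: gap_cone_def spread_def)
    then show ?thesis
      unfolding g v_def by (cases "\<sigma> < \<tau>") (simp_all add: word_act_diff spread_diff)
  qed
  obtain c C where cC: "0 < c"
    "\<And>j v. v \<in> gap_cone \<Longrightarrow> c * \<rho> ^ j * spread v \<le> spread (word_act (concat (replicate j p)) v)"
    "\<And>j v. v \<in> gap_cone \<Longrightarrow> spread (word_act (concat (replicate j p)) v) \<le> C * \<rho> ^ j * spread v"
    by (rule left_eigen_growth[OF p(2)]) blast
  define c' C' where "c' = (2/5) ^ length w * (c * spread v)" and "C' = C * spread v"
  have bounds: "c' * \<rho> ^ j \<le> g (r * q ^ j)" "g (r * q ^ j) \<le> C' * \<rho> ^ j" for j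
  proof -
    let ?z = "word_act (concat (replicate j p)) v"
    have "?z \<in> gap_cone" by (rule word_act_in_cone[OF vc])
    note z = spread_word_act[OF this, of w]
    have "(2/5) ^ length w * (c * \<rho> ^ j * spread v) \<le> (2/5) ^ length w * spread ?z"
      using cC(2)[OF vc] by (intro mult_left_mono) auto
    then have "(2/5) ^ length w * (c * \<rho> ^ j * spread v) \<le> g (r * q ^ j)"
      using z(1) unfolding sample word_act_append by (rule order_trans)
    then show "c' * \<rho> ^ j \<le> g (r * q ^ j)" unfolding c'_def by (simp only: mult_ac)
    show "g (r * q ^ j) \<le> C' * \<rho> ^ j"
      using order_trans[OF z(2) cC(3)[OF vc, of j]]
      unfolding sample word_act_append C'_def by (simp only: mult_ac)
  qed
  have q01: "0 < q" "q < 1" using p(1) by (auto simp: q_def power_one_over)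
  have \<rho>: "0 < \<rho>" using p(2) by (simp add: left_eigen_def)
  have rpos: "0 < r" by (simp add: r_def)
  have "0 < c'" using cC(1) vpos by (simp add: c'_def)
  from log_growth_of_geometric_samples[OF q01 \<rho> rpos this mono bounds]
  obtain B where B: "\<And>\<theta>. 0 < \<theta> \<Longrightarrow> \<theta> \<le> r \<Longrightarrow> 0 < g \<theta>"
    "\<And>\<theta>. 0 < \<theta> \<Longrightarrow> \<theta> \<le> r \<Longrightarrow> \<bar>ln (g \<theta>) - ln \<rho> / ln q * ln \<theta>\<bar> \<le> B"
    by blast
  define e where "e = ln \<rho> / (real (length p) * ln (1/2))"
  have e: "ln \<rho> / ln q = e" by (simp add: e_def q_def ln_realpow)
  obtain d D where dD: "0 < d" "\<And>v. v \<in> gap_cone \<Longrightarrow> d * spread v \<le> N v"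
    "\<And>v. v \<in> gap_cone \<Longrightarrow> N v \<le> D * spread v"
    by (rule norm_comparable_to_spread[OF N]) blast
  have "\<bar>ln (N (u t - u s)) - e * ln \<bar>t - s\<bar>\<bar>
      \<le> \<bar>ln d\<bar> + \<bar>ln D\<bar> + B + \<bar>e * ln \<bar>\<tau> - \<sigma>\<bar>\<bar>"
    if t: "0 < (t - s) * (\<tau> - \<sigma>)" "\<bar>t - s\<bar> \<le> r * \<bar>\<tau> - \<sigma>\<bar>" for t
  proof -
    define \<theta> where "\<theta> = (t - s) / (\<tau> - \<sigma>)"
    have pos: "0 < \<theta>" using t(1) by (auto simp: \<theta>_def zero_less_mult_iff zero_less_divide_iff)
    then have "\<theta> = \<bar>t - s\<bar> / \<bar>\<tau> - \<sigma>\<bar>" unfolding \<theta>_def by (metis abs_divide abs_of_pos)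
    with t \<tau>(2) have abs: "\<bar>t - s\<bar> = \<theta> * \<bar>\<tau> - \<sigma>\<bar>" and le: "\<theta> \<le> r"
      by (auto simp: divide_le_eq)
    have t_eq: "s + \<theta> * (\<tau> - \<sigma>) = t" using \<tau>(2) by (simp add: \<theta>_def)
    have t01: "t \<in> {0..1}" using in_unit[OF pos le] by (simp add: t_eq)
    define z where "z = (if s \<le> t then u t - u s else u s - u t)"
    have zc: "z \<in> gap_cone"
      using s01 t01 by (auto simp: z_def intro!: curve_increment_in_cone[OF u])
    then have "0 \<le> spread z" by (simp add: gap_cone_def spread_def)
    then have zg: "spread z = g \<theta>"
      unfolding g_def t_eq by (auto simp: z_def spread_diff split: if_splits)
    have S: "0 < spread z" using B(1)[OF pos le] by (simp add: zg)
    have "N (- 1 *\<^sub>R y) = N y" for y using N unfolding is_norm_def by (metis abs_minus_cancel abs_one mult_1)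
    from this[of "u t - u s"] have Nz: "N (u t - u s) = N z" by (simp add: z_def)
    note NS = dD(2,3)[OF zc]
    have pos_dS: "0 < d * spread z" using dD(1) S by simp
    then have "0 < N z" using NS(1) by linarith
    moreover have "0 < D" using NS(2) \<open>0 < N z\<close> S by (metis less_le_trans zero_less_mult_pos2)
    ultimately have "0 < D" "ln (d * spread z) \<le> ln (N z)" "ln (N z) \<le> ln (D * spread z)"
      using NS pos_dS by (simp_all only: ln_mono)
    then have "\<bar>ln (N z) - ln (g \<theta>)\<bar> \<le> \<bar>ln d\<bar> + \<bar>ln D\<bar>"
      using dD(1) S by (simp add: ln_mult zg)
    moreover have "\<bar>ln (g \<theta>) - e * ln \<theta>\<bar> \<le> B" using B(2)[OF pos le] by (simp add: e)
    moreover have "e * ln \<bar>t - s\<bar> = e * ln \<theta> + e * ln \<bar>\<tau> - \<sigma>\<bar>"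
      unfolding abs using pos \<tau>(2) by (simp add: ln_mult distrib_left)
    ultimately show ?thesis unfolding Nz by linarith
  qed
  moreover have "0 < r * \<bar>\<tau> - \<sigma>\<bar>" using rpos \<tau>(2) by simp
  ultimately show ?thesis unfolding e_def by blast
qed

text \<open>The error, bounded by $B$, is divided by $\ln \<bar>t - s\<bar>$, which tends to $-\<infinity>$. This
is also why the choice of the norm does not influence the exponent.\<close>

lemma tendsto_log_quotient:
  fixes s :: real
  assumes r: "r > 0" and B: "\<And>t. t \<in> A \<Longrightarrow> t \<noteq> s \<Longrightarrow> \<bar>t - s\<bar> \<le> r \<Longrightarrow> \<bar>f t - e * ln \<bar>t - s\<bar>\<bar> \<le> B"
  shows "((\<lambda>t. f t / ln \<bar>t - s\<bar>) \<longlongrightarrow> e) (at s within A)"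
proof -
  have "((\<lambda>t. \<bar>t - s\<bar>) \<longlongrightarrow> \<bar>s - s\<bar>) (at s within A)" by (intro tendsto_intros)
  then have "filterlim (\<lambda>t. \<bar>t - s\<bar>) (at_right 0) (at s within A)"
    by (auto simp: filterlim_at eventually_at_filter)
  then have "filterlim (\<lambda>t. ln \<bar>t - s\<bar>) at_bot (at s within A)"
    by (rule filterlim_compose[OF ln_at_0])
  then have "filterlim (\<lambda>t. ln \<bar>t - s\<bar>) at_infinity (at s within A)"
    by (rule filterlim_mono[OF _ at_bot_le_at_infinity order_refl])
  then have lim: "((\<lambda>t. \<bar>B / ln \<bar>t - s\<bar>\<bar>) \<longlongrightarrow> 0) (at s within A)"
    by (intro tendsto_rabs_zero tendsto_divide_0[OF tendsto_const])
  have "\<forall>\<^sub>F t in at s within A. norm (f t / ln \<bar>t - s\<bar> - e) \<le> \<bar>B / ln \<bar>t - s\<bar>\<bar>"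
    unfolding eventually_at
  proof (intro exI[of _ "min r 1"] conjI ballI impI)
    fix t assume t: "t \<in> A" "t \<noteq> s \<and> dist t s < min r 1"
    then have "ln \<bar>t - s\<bar> < 0" by (simp add: dist_real_def)
    then have "f t / ln \<bar>t - s\<bar> - e = (f t - e * ln \<bar>t - s\<bar>) / ln \<bar>t - s\<bar>"
      by (simp add: field_simps)
    moreover have "\<bar>f t - e * ln \<bar>t - s\<bar>\<bar> \<le> \<bar>B\<bar>" using B[of t] t by (force simp: dist_real_def)
    ultimately show "norm (f t / ln \<bar>t - s\<bar> - e) \<le> \<bar>B / ln \<bar>t - s\<bar>\<bar>"
      by (simp add: abs_divide divide_right_mono)
  qed (use r in simp)
  from Lim_null_comparison[OF this lim] show ?thesis by (simp add: LIM_zero_iff)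
qed

section \<open>Periodic binary expansions\<close>

definition binary_tail :: "(nat \<Rightarrow> nat) \<Rightarrow> nat \<Rightarrow> real" where
  "binary_tail a m = (\<Sum>i. real (a (m + i)) * (1/2) ^ Suc i)"

lemma binary_tail_props:
  assumes "\<forall>i\<ge>m. a i \<in> {0, 1}"
  shows "binary_tail a m \<in> {0..1}" and "binary_tail a m = word_map [a m] (binary_tail a (Suc m))"
proof -
  have geo: "(\<lambda>i. (1/2 :: real) ^ Suc i) sums 1" by (rule power_half_series)
  have bd: "real (a (m + i)) \<le> 1" for i using assms[rule_format, of "m + i"] by auto
  let ?f = "\<lambda>i. real (a (m + i)) * (1/2) ^ Suc i"
  have le: "?f i \<le> (1/2) ^ Suc i" for i using mult_right_mono[OF bd, of "(1/2) ^ Suc i" i] by simp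
  have sm: "summable ?f"
    by (rule summable_comparison_test'[OF sums_summable[OF geo], of 0])
       (use le in \<open>simp del: power_Suc\<close>)
  have "suminf ?f \<le> (\<Sum>i. (1/2) ^ Suc i)" by (rule suminf_le[OF le sm sums_summable[OF geo]])
  moreover have "0 \<le> suminf ?f" by (rule suminf_nonneg[OF sm]) simp
  ultimately show "binary_tail a m \<in> {0..1}" using sums_unique[OF geo] by (simp add: binary_tail_def)
  have "(\<Sum>i. ?f (Suc i)) = binary_tail a m - real (a m) / 2"
    using suminf_split_head[OF sm] by (simp add: binary_tail_def)
  moreover have "?f (Suc i) = (1/2) * (real (a (Suc m + i)) * (1/2) ^ Suc i)" for i by simp
  moreover have "summable (\<lambda>i. real (a (Suc m + i)) * (1/2) ^ Suc i)"
  proof -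
    have "summable (\<lambda>i. 2 * ?f (Suc i))" by (intro summable_mult summable_Suc_iff[of ?f, THEN iffD2] sm)
    then show ?thesis by simp
  qed
  ultimately have "1/2 * binary_tail a (Suc m) = binary_tail a m - real (a m) / 2"
    by (simp only: binary_tail_def suminf_mult)
  moreover have "a m = 0 \<or> a m = 1" using assms by simp
  ultimately show "binary_tail a m = word_map [a m] (binary_tail a (Suc m))"
    by (auto simp: h0_def h1_def)
qed

lemma binary_tail_word:
  assumes "\<forall>i\<ge>m. a i \<in> {0, 1}"
  shows "binary_tail a m = word_map (map a [m..<m + j]) (binary_tail a (m + j))"
proof (induction j)
  case (Suc j)
  then show ?case using binary_tail_props(2)[of "m + j" a] assms by (simp add: word_map_append)
qed simp

text \<open>An expansion of 0, or of 1, is constant. This identifies the period when one side of $s$ is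
out of its reach.\<close>

lemma word_map_eq_zero:
  "x \<in> {0..1} \<Longrightarrow> word_map w x = 0 \<Longrightarrow> w = replicate (length w) 0"
proof (induction w)
  case (Cons i w)
  then show ?case using word_map_in_unit[of x w] by (auto simp: h0_def h1_def split: if_splits)
qed simp

lemma word_map_eq_one:
  "set w \<subseteq> {0, 1} \<Longrightarrow> x \<in> {0..1} \<Longrightarrow> word_map w x = 1 \<Longrightarrow> w = replicate (length w) 1"
proof (induction w)
  case (Cons i w)
  then show ?case using word_map_in_unit[of x w] by (auto simp: h0_def h1_def split: if_splits)
qed simp

text \<open>A positive number reached from 0 by a word is dyadic; replacing the last digit 1 by 0 and
continuing with digits 1 gives its other expansion.\<close>

lemma other_word_zero: "word_map w 0 > 0 \<Longrightarrow> \<exists>q. word_map w 0 = word_map q 1"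
proof (induction w rule: rev_induct)
  case (snoc i w)
  show ?case
  proof (cases "i = 0")
    case True
    then show ?thesis using snoc by (auto simp: word_map_append h0_def)
  next
    case False
    then have "word_map (w @ [i]) 0 = word_map (w @ [0]) 1"
      by (simp add: word_map_append h0_def h1_def)
    then show ?thesis by blast
  qed
qed simp

text \<open>The mirror image of the preceding fact: the last digit 0 becomes 1, followed by digits 0.\<close>

lemma other_word_one: "word_map w 1 < 1 \<Longrightarrow> \<exists>q. word_map w 1 = word_map q 0"
proof (induction w rule: rev_induct)
  case (snoc i w)
  show ?case
  proof (cases "i = 0")
    case True
    then have "word_map (w @ [i]) 1 = word_map (w @ [1]) 0"
      by (simp add: word_map_append h0_def h1_def)
    then show ?thesis by blast
  next
    case False
    then show ?thesis using snoc by (auto simp: word_map_append h1_def)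
  qed
qed simp

theorem theorem12:
  fixes u :: "real \<Rightarrow> real^3" and N :: "real^3 \<Rightarrow> real"
    and s :: real and a :: "nat \<Rightarrow> nat" and n k :: nat and p :: "nat list"
  assumes "is_curve u"
    and "is_norm N"
    and "s \<in> {0..1} \<inter> \<rat>"
    and "lower_binary_expansion a s \<or> upper_binary_expansion a s"
    and "n \<ge> 1" and "k \<ge> 1" and "\<forall>i\<ge>k. a (i + n) = a i"
    and "p = map a [k..<k + n]"
  shows "card (eigenvalues_on plane (vecM_word p)) = 2
    \<and> (\<forall>c\<in>eigenvalues_on plane (vecM_word p). c > 0)
    \<and> has_holder_exponent N u s
        (ln (Max (eigenvalues_on plane (vecM_word p))) / (real n * ln (1/2)))"
proof (intro conjI)
  have p: "p \<noteq> []" "length p = n" using assms(5,8) by auto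
  show "card (eigenvalues_on plane (vecM_word p)) = 2"
    "\<forall>c\<in>eigenvalues_on plane (vecM_word p). c > 0"
    by (rule perron_word_Max[OF p(1)])+
  define \<rho> where "\<rho> = Max (eigenvalues_on plane (vecM_word p))"
  have \<rho>: "left_eigen p \<rho>" unfolding \<rho>_def by (rule perron_word_Max(3)[OF p(1)])
  define \<sigma> where "\<sigma> = binary_tail a k"
  have exp: "binary_expansion a s"
    using assms(4) by (auto simp: lower_binary_expansion_def upper_binary_expansion_def)
  then have dig: "\<forall>i\<ge>1. a i \<in> {0, 1}" by (simp add: binary_expansion_def)
  then have dig_k: "\<forall>i\<ge>k. a i \<in> {0, 1}" using assms(6) by auto
  have \<sigma>01: "\<sigma> \<in> {0..1}" unfolding \<sigma>_def by (rule binary_tail_props(1)[OF dig_k])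
  have "s = binary_tail a 1"
    using exp by (auto simp: binary_expansion_def binary_tail_def dest: sums_unique)
  then have s: "s = word_map (map a [1..<k]) \<sigma>"
    using binary_tail_word[OF dig, of "k - 1"] assms(6) by (simp add: \<sigma>_def)
  have "a (k + n + i) = a (k + i)" for i
    using assms(7)[rule_format, of "k + i"] by (simp add: ac_simps)
  then have "binary_tail a (k + n) = \<sigma>" by (simp add: binary_tail_def \<sigma>_def)
  with binary_tail_word[OF dig_k, of n] have fixed: "word_map p \<sigma> = \<sigma>"
    unfolding assms(8) \<sigma>_def[symmetric] by metis
  have s01: "s \<in> {0..1}" using assms(3) by simp
  have end_word: "\<rho> = (3/5)^n" if "\<sigma> = 0 \<or> \<sigma> = 1"
  proof -
    have "set p \<subseteq> {0, 1}" using dig_k assms(8) by auto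
    with that have "p = replicate n 0 \<or> p = replicate n 1"
      using word_map_eq_zero[of \<sigma> p] word_map_eq_one[of p \<sigma>] fixed \<sigma>01 p(2) by auto
    then show ?thesis using Max_eigenvalue_replicate[OF assms(5)] by (auto simp: \<rho>_def)
  qed
  have flat: "left_eigen (replicate n i) ((3/5)^n)" if "i \<in> {0, 1}" for i
    using perron_word_Max(3)[of "replicate n i"] Max_eigenvalue_replicate[OF assms(5)] that assms(5)
    by auto
  let ?e = "ln \<rho> / (real n * ln (1/2))"
  let ?dev = "\<lambda>t. \<bar>ln (N (u t - u s)) - ?e * ln \<bar>t - s\<bar>\<bar>"
  have side: "\<exists>r>0. \<exists>B. \<forall>t\<in>{0..1}. 0 < (t - s) * d \<and> \<bar>t - s\<bar> \<le> r \<longrightarrow> ?dev t \<le> B"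
    if "length w = n" "left_eigen w \<rho>" "x \<in> {0..1}" "word_map w x = x" "y \<in> {0, 1}"
      "s = word_map v x" "0 < d * (y - x)" for d w x y v
  proof -
    have "w \<noteq> []" "y \<noteq> x" using that assms(5) by auto
    note growth = one_sided_log_growth[OF assms(1,2) this(1) that(2,3,4,5) this(2) that(6), unfolded that(1)]
    have sign: "0 < (t - s) * d \<longleftrightarrow> 0 < (t - s) * (y - x)" for t
      using that(7) by (auto simp: zero_less_mult_iff)
    obtain r B where "r > 0"
      and "\<forall>t. 0 < (t - s) * (y - x) \<and> \<bar>t - s\<bar> \<le> r \<longrightarrow> ?dev t \<le> B"
      using growth by (elim exE conjE) (rule that)
    then show ?thesis unfolding sign by (intro exI[of _ r] exI[of _ B] conjI) simp_all
  qed
  \<comment> \<open>Only for \<open>\<sigma> = 1\<close> does the given expansion miss the parameters to the right of \<open>s\<close>; the expansion with period 0 then replaces it.\<close>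
  have right: "\<exists>r>0. \<exists>B. \<forall>t\<in>{0..1}. 0 < (t - s) * 1 \<and> \<bar>t - s\<bar> \<le> r \<longrightarrow> ?dev t \<le> B"
  proof -
    consider "\<sigma> < 1" | "s = 1" | "\<sigma> = 1" "s < 1" using \<sigma>01 s01 by fastforce
    then show ?thesis
    proof cases
      case 1
      then show ?thesis by (intro side[OF p(2) \<rho> \<sigma>01 fixed _ s, of 1]) auto
    next
      case 2
      then show ?thesis by (intro exI[of _ 1]) auto
    next
      case 3
      then obtain v where "s = word_map v 0" using s other_word_one by auto
      then show ?thesis
        using flat[of 0] end_word 3
        by (intro side[of "replicate n 0" 0 1 v]) (auto simp: word_map_replicate)
    qed
  qed
  \<comment> \<open>Symmetrically, for \<open>\<sigma> = 0\<close> the parameters to the left are reached by the expansion with period 1.\<close>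
  have left: "\<exists>r>0. \<exists>B. \<forall>t\<in>{0..1}. 0 < (t - s) * (- 1) \<and> \<bar>t - s\<bar> \<le> r \<longrightarrow> ?dev t \<le> B"
  proof -
    consider "\<sigma> > 0" | "s = 0" | "\<sigma> = 0" "s > 0" using \<sigma>01 s01 by fastforce
    then show ?thesis
    proof cases
      case 1
      then show ?thesis by (intro side[OF p(2) \<rho> \<sigma>01 fixed _ s, of 0]) auto
    next
      case 2
      then show ?thesis by (intro exI[of _ 1]) auto
    next
      case 3
      then obtain v where "s = word_map v 1" using s other_word_zero by auto
      then show ?thesis
        using flat[of 1] end_word 3
        by (intro side[of "replicate n 1" 1 0 v]) (auto simp: word_map_replicate simp del: One_nat_def)
    qed
  qed
  obtain r B where r: "r > 0"
    and B: "\<forall>t\<in>{0..1}. 0 < (t - s) * 1 \<and> \<bar>t - s\<bar> \<le> r \<longrightarrow> ?dev t \<le> B"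
    using right by (elim exE conjE) (rule that)
  obtain r' B' where r': "r' > 0"
    and B': "\<forall>t\<in>{0..1}. 0 < (t - s) * (- 1) \<and> \<bar>t - s\<bar> \<le> r' \<longrightarrow> ?dev t \<le> B'"
    using left by (elim exE conjE) (rule that)
  have "?dev t \<le> max B B'" if t: "t \<in> {0..1}" "t \<noteq> s" "\<bar>t - s\<bar> \<le> min r r'" for t
  proof (cases "t > s")
    case True
    then have "?dev t \<le> B" using t by (intro B[rule_format]) simp_all
    then show ?thesis by (rule order_trans) simp
  next
    case False
    then have "?dev t \<le> B'" using t by (intro B'[rule_format]) simp_all
    then show ?thesis by (rule order_trans) simp
  qed
  moreover have "0 < min r r'" using r r' by simp
  ultimately show "has_holder_exponent N u s
      (ln (Max (eigenvalues_on plane (vecM_word p))) / (real n * ln (1/2)))"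
    unfolding has_holder_exponent_def \<rho>_def[symmetric]
    by (intro tendsto_log_quotient[of "min r r'" _ _ _ _ "max B B'"])
qed

end
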